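(* Let $B$ be a $\Delta$-regular $N\times N$ boolean matrix with $\Delta\leq N/2$, and let $S=2B-J$ be its signed version ($J$ the all-ones matrix). Then $$\text{sign-rank}(S)\geq \frac{\Delta}{\sigma_2(B)}.$$
   Context: A boolean ($0/1$) matrix is $\Delta$-regular if every row and every column has exactly $\Delta$ ones. $\sigma_1(B)\ge\sigma_2(B)\ge\dots$ are the singular values of $B$. The sign rank of a $\pm1$ matrix $S$ is $\min\{\text{rank}(M): \text{sign}(M)=S\}$ over real matrices $M$ with no zero entries ($\text{sign}$ entrywise, rank over $\mathbb R$). *)

theory Defs
  imports "HOL-Analysis.Analysis" "HOL-Library.Multiset"
begin

definition boolean_matrix :: "real^'n^'m \<Rightarrow> bool" where
  "boolean_matrix B \<longleftrightarrow> (\<forall>i j. B $ i $ j = 0 \<or> B $ i $ j = 1)"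

definition regular_matrix :: "nat \<Rightarrow> real^'n^'m \<Rightarrow> bool" where
  "regular_matrix \<Delta> B \<longleftrightarrow>
     (\<forall>i. card {j. B $ i $ j = 1} = \<Delta>) \<and> (\<forall>j. card {i. B $ i $ j = 1} = \<Delta>)"

definition all_ones :: "real^'n^'m" where
  "all_ones = (\<chi> i j. 1)"

definition eigenspace :: "real^'n^'n \<Rightarrow> real \<Rightarrow> (real^'n) set" where
  "eigenspace M l = {x. M *v x = l *\<^sub>R x}"

definition eigenvalues :: "real^'n^'n \<Rightarrow> real set" where
  "eigenvalues M = {l. \<exists>x. x \<noteq> 0 \<and> x \<in> eigenspace M l}"

lemma finite_eigenvalues_symmetric:
  fixes M :: "real^'n^'n"
  assumes sym: "transpose M = M"
  shows "finite (eigenvalues M)"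
proof -
  define f where "f l = (SOME x. x \<noteq> 0 \<and> x \<in> eigenspace M l)" for l
  have f: "f l \<noteq> 0" "M *v f l = l *\<^sub>R f l" if "l \<in> eigenvalues M" for l
    using someI_ex[of "\<lambda>x. x \<noteq> 0 \<and> x \<in> eigenspace M l"] that
    unfolding f_def eigenvalues_def eigenspace_def by auto
  have ip: "f l \<bullet> f k = 0" if "l \<in> eigenvalues M" "k \<in> eigenvalues M" "l \<noteq> k" for l k
  proof -
    have "(M *v f l) \<bullet> f k = f l \<bullet> (M *v f k)"
      by (metis dot_lmul_matrix sym transpose_matrix_vector)
    then have "(l - k) * (f l \<bullet> f k) = 0"
      using f[OF that(1)] f[OF that(2)] by (simp add: algebra_simps)
    then show ?thesis using that by simp
  qed
  have inj: "inj_on f (eigenvalues M)"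
    by (rule inj_onI) (metis ip f(1) inner_eq_zero_iff)
  have "pairwise orthogonal (f ` eigenvalues M)"
    unfolding pairwise_def orthogonal_def using ip by blast
  moreover have "0 \<notin> f ` eigenvalues M" using f(1) by force
  ultimately have "independent (f ` eigenvalues M)"
    by (rule pairwise_orthogonal_independent)
  then show ?thesis
    using finiteI_independent finite_imageD inj by blast
qed

text \<open>
  The singular values of A are the square roots of the eigenvalues of the symmetric positive
  semidefinite matrix \<open>transpose A ** A\<close>, repeated according to multiplicity (for a symmetric
  matrix, the dimension of the eigenspace) and listed in decreasing order. The index set of the
  sum is finite by \<open>finite_eigenvalues_symmetric\<close>.
\<close>
definition singular_values :: "real^'n^'m \<Rightarrow> real list" where
  "singular_values A = rev (sorted_list_of_multiset
     (\<Sum>l\<in>eigenvalues (transpose A ** A).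
        replicate_mset (dim (eigenspace (transpose A ** A) l)) (sqrt l)))"

text \<open>Numbered from 1; meaningful for \<open>k \<in> {1..CARD('n)}\<close>.\<close>
definition singular_value :: "nat \<Rightarrow> real^'n^'m \<Rightarrow> real" where
  "singular_value k A = singular_values A ! (k - 1)"

text \<open>The set below contains \<open>rank S\<close> whenever all entries of S are 1 or -1.\<close>
definition sign_rank :: "real^'n^'m \<Rightarrow> nat" where
  "sign_rank S = Inf {rank M | M :: real^'n^'m.
     \<forall>i j. M $ i $ j \<noteq> 0 \<and> sgn (M $ i $ j) = S $ i $ j}"

end

theory Submission
  imports Defs
begin

text \<open>
  A matrix \<open>M\<close> of rank \<open>d\<close> realizing the sign pattern of \<open>S\<close> factors as \<open>M $ i $ j = u i \<bullet> v j\<close> with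
  vectors in a subspace of dimension \<open>d\<close>. By Forster's argument, after a perturbation of the \<open>v j\<close>
  into general position and a linear change of coordinates one obtains unit vectors \<open>a i\<close>, \<open>b j\<close> with the same
  sign pattern such that the \<open>b j\<close> are nearly isotropic, that is \<open>\<Sum>j. (a i \<bullet> b j)\<^sup>2\<close> is at least
  \<open>N / d - \<epsilon>\<close> for every \<open>i\<close>. The change of coordinates nearly minimizes
  \<open>\<Sum>j. ln |T v j|\<^sup>2 - (N / d) ln (det T)\<^sup>2\<close>: if some direction were too light,
  stretching along it would decrease this potential by a fixed amount.

  Pair \<open>E = B - (\<Delta> / N) J\<close> with the matrix \<open>a i \<bullet> b j\<close>. As \<open>\<Delta> \<le> N / 2\<close>, every
  entry satisfies \<open>E $ i $ j * (a i \<bullet> b j) \<ge> (\<Delta> / N) * (a i \<bullet> b j)\<^sup>2\<close>, so the pairing is at least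
  \<open>\<Delta> * (N / d - \<epsilon>)\<close>. It is at most \<open>N\<close> times the norm of \<open>B\<close> on the
  orthogonal complement of the all-ones vector, which is a singular vector of \<open>B\<close>.
\<close>

section \<open>General position inside a subspace\<close>

text \<open>Adding the orthogonal complement of \<open>W\<close> turns each \<open>Y\<close> into a
  proper subspace of the whole space, which is Lebesgue negligible. A point near \<open>v\<close>
  outside all of these is projected back to \<open>W\<close>.\<close>

lemma exists_open_subspace_avoiding_subspaces:
  fixes W :: "'a::euclidean_space set"
  assumes W: "subspace W" and fin: "finite X"
    and X: "\<And>Y. Y \<in> X \<Longrightarrow> subspace Y \<and> Y \<subseteq> W \<and> dim Y < dim W"
    and U: "open U" "v \<in> U" "v \<in> W"
  shows "\<exists>w \<in> U \<inter> W. w \<notin> \<Union>X"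
proof -
  obtain p where p: "p x \<in> W" "x - p x \<in> W\<^sup>\<bottom>" for x
  proof -
    have "\<exists>y \<in> W. x - y \<in> W\<^sup>\<bottom>" for x
    proof -
      obtain y z where "y \<in> span W" "\<And>w. w \<in> span W \<Longrightarrow> orthogonal z w" "x = y + z"
        using orthogonal_subspace_decomp_exists by blast
      then show ?thesis
        using W by (intro bexI[of _ y]) (auto simp: orthogonal_comp_def orthogonal_commute span_base
            span_eq_iff[THEN iffD2, OF W])
    qed
    then show ?thesis using that by metis
  qed
  obtain e where e: "e > 0" "ball v e \<subseteq> U"
    using U openE by blast
  \<comment> \<open>As \<open>v\<close> lies in \<open>W\<close>, the orthogonal projection
    \<open>p\<close> does not increase the distance to \<open>v\<close>.\<close>
  have near: "p y \<in> ball v e" if "y \<in> ball v e" for y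
  proof -
    have "orthogonal (v - p y) (p y - y)"
      using p[of y] U(3) W unfolding orthogonal_comp_def orthogonal_def
      by (simp add: inner_diff_right inner_diff_left algebra_simps)
    then have "(norm (v - y))\<^sup>2 = (norm (v - p y))\<^sup>2 + (norm (p y - y))\<^sup>2"
      using norm_add_Pythagorean[of "v - p y" "p y - y"] by simp
    then have "norm (v - p y) \<le> norm (v - y)"
      by (simp add: power2_le_imp_le)
    then show ?thesis using that by (simp add: dist_norm)
  qed
  have dW: "dim (W\<^sup>\<bottom>) + dim W = DIM('a)"
    using dim_subspace_orthogonal_to_vectors[OF W subspace_UNIV]
    by (simp add: orthogonal_comp_def)
  have "negligible (span (Y \<union> W\<^sup>\<bottom>))" if "Y \<in> X" for Y
  proof (rule negligible_lowdim)
    have "dim (Y \<union> W\<^sup>\<bottom>) \<le> dim Y + dim (W\<^sup>\<bottom>)"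
    proof -
      have "span (Y \<union> W\<^sup>\<bottom>) = {x + y |x y. x \<in> Y \<and> y \<in> W\<^sup>\<bottom>}"
        using span_Un[of Y "W\<^sup>\<bottom>"] span_eq_iff[THEN iffD2, OF conjunct1[OF X[OF that]]]
          span_eq_iff[THEN iffD2, OF subspace_orthogonal_comp[of W]] by (simp only:)
      then have "dim (span (Y \<union> W\<^sup>\<bottom>)) + dim (Y \<inter> W\<^sup>\<bottom>) = dim Y + dim (W\<^sup>\<bottom>)"
        using dim_sums_Int[of Y "W\<^sup>\<bottom>"] X[OF that] subspace_orthogonal_comp[of W] by auto
      then show ?thesis by simp
    qed
    then show "dim (span (Y \<union> W\<^sup>\<bottom>)) < DIM('a)"
      using X[OF that] dW by simp
  qed
  then have "negligible (\<Union>Y\<in>X. span (Y \<union> W\<^sup>\<bottom>))"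
    using fin by (intro negligible_Union) auto
  then obtain y where y: "y \<in> ball v e" "y \<notin> (\<Union>Y\<in>X. span (Y \<union> W\<^sup>\<bottom>))"
    by (metis e(1) negligible_subset open_ball open_not_negligible subsetI ball_eq_empty not_le)
  have "p y \<notin> Y" if "Y \<in> X" for Y
  proof
    assume "p y \<in> Y"
    then have "p y + (y - p y) \<in> span (Y \<union> W\<^sup>\<bottom>)"
      using p by (intro span_add span_base) auto
    then show False using y(2) that by auto
  qed
  then show ?thesis
    using near[OF y(1)] e(2) p(1) by blast
qed

text \<open>The vectors are chosen one at a time, each outside the spans of all sets of fewer than
  \<open>dim W\<close> earlier ones. Injectivity is recorded because \<open>independent\<close>
  speaks of the image set and would not notice repeated vectors.\<close>

lemma exists_general_position:
  fixes W :: "'a::euclidean_space set" and U :: "'i \<Rightarrow> 'a set"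
  assumes W: "subspace W" and fin: "finite F"
    and U: "\<And>j. j \<in> F \<Longrightarrow> open (U j) \<and> U j \<inter> W \<noteq> {}"
  shows "\<exists>v. (\<forall>j\<in>F. v j \<in> U j \<inter> W) \<and>
    (\<forall>I\<subseteq>F. card I \<le> dim W \<longrightarrow> inj_on v I \<and> independent (v ` I))"
  using fin U
proof (induction F rule: finite_induct)
  case empty
  then show ?case by (auto simp: independent_empty)
next
  case (insert j F)
  then obtain v where v: "\<And>i. i \<in> F \<Longrightarrow> v i \<in> U i \<inter> W"
    and ind: "\<And>I. I \<subseteq> F \<Longrightarrow> card I \<le> dim W \<Longrightarrow> inj_on v I \<and> independent (v ` I)"
    by (metis insertI2)
  define X where "X = (\<lambda>I. span (v ` I)) ` {I. I \<subseteq> F \<and> card I < dim W}"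
  have "finite X" unfolding X_def using insert.hyps by simp
  have X: "subspace Y \<and> Y \<subseteq> W \<and> dim Y < dim W" if Y: "Y \<in> X" for Y
  proof -
    obtain I where I: "Y = span (v ` I)" "I \<subseteq> F" "card I < dim W"
      using Y unfolding X_def by auto
    have "finite I" using I insert.hyps finite_subset by blast
    then have "dim (v ` I) \<le> card I"
      by (meson card_image_le dim_le_card' finite_imageI order_trans)
    moreover have "Y \<subseteq> W" unfolding I(1)
      using v I W by (intro span_minimal) auto
    ultimately show ?thesis using I by simp
  qed
  obtain w where w: "w \<in> U j \<inter> W" "w \<notin> \<Union>X"
    using exists_open_subspace_avoiding_subspaces[OF W \<open>finite X\<close> X] insert.prems[of j] by blast
  have "inj_on (v(j := w)) I \<and> independent ((v(j := w)) ` I)"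
    if I: "I \<subseteq> insert j F" "card I \<le> dim W" for I
  proof (cases "j \<in> I")
    case False
    then have "I \<subseteq> F" "inj_on (v(j := w)) I = inj_on v I" "(v(j := w)) ` I = v ` I"
      using I by (auto simp: inj_on_def)
    then show ?thesis using ind I by simp
  next
    case True
    define K where "K = I - {j}"
    have K: "K \<subseteq> F" "I = insert j K" "j \<notin> K" "finite K"
      using I True insert.hyps finite_subset unfolding K_def by auto
    then have cK: "card K < dim W" using I by simp
    then have "span (v ` K) \<in> X" using K X_def by auto
    then have "w \<notin> span (v ` K)" using w by blast
    moreover have "(v(j := w)) ` K = v ` K" "inj_on (v(j := w)) K = inj_on v K"
      using K(3) by (auto simp: inj_on_def)
    moreover have "w \<notin> v ` K" using calculation span_base by blast
    moreover have "inj_on v K \<and> independent (v ` K)" using ind K cK by simp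
    ultimately show ?thesis
      using K by (auto simp: independent_insert)
  qed
  moreover have "(v(j := w)) i \<in> U i \<inter> W" if "i \<in> insert j F" for i
    using v w that by auto
  ultimately show ?case by blast
qed

section \<open>Determinant estimates\<close>

text \<open>A crude form of Hadamard's inequality, by the triangle inequality in the Leibniz
  formula. The factorial is harmless: it only enters a positive constant.\<close>

lemma abs_det_le_prod_norm_column:
  fixes A :: "real^'n^'n"
  shows "\<bar>det A\<bar> \<le> fact CARD('n) * (\<Prod>k\<in>UNIV. norm (column k A))"
proof -
  let ?P = "{p. p permutes (UNIV::'n set)}"
  have "\<bar>det (transpose A)\<bar> \<le> (\<Sum>p\<in>?P. \<bar>of_int (sign p) * (\<Prod>i\<in>UNIV. transpose A $ i $ p i)\<bar>)"
    unfolding det_def by (rule sum_abs)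
  also have "\<dots> \<le> (\<Sum>p\<in>?P. (\<Prod>k\<in>UNIV. norm (column k A)))"
  proof (rule sum_mono)
    fix p assume "p \<in> ?P"
    have "\<bar>transpose A $ i $ p i\<bar> \<le> norm (column i A)" for i
      using component_le_norm_cart[of "column i A" "p i"] by (simp add: column_def transpose_def)
    then have "(\<Prod>i\<in>UNIV. \<bar>transpose A $ i $ p i\<bar>) \<le> (\<Prod>k\<in>UNIV. norm (column k A))"
      by (intro prod_mono) auto
    then show "\<bar>of_int (sign p) * (\<Prod>i\<in>UNIV. transpose A $ i $ p i)\<bar> \<le> (\<Prod>k\<in>UNIV. norm (column k A))"
      by (simp add: abs_mult abs_prod sign_def)
  qed
  finally show ?thesis
    by (simp add: card_permutations)
qed

text \<open>An orthogonal change of basis taking a coordinate vector to \<open>x\<close> makes the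
  matrix diagonal, with one entry \<open>1 + s\<close> and all others 1.\<close>

lemma det_rank_one_perturbation:
  fixes x :: "real^'n"
  assumes "norm x = 1"
  shows "det ((\<chi> i j. (if i = j then 1 else 0) + s * (x $ i * x $ j)) :: real^'n^'n) = 1 + s"
    (is "det ?E = _")
proof -
  obtain k :: 'n where True by simp
  obtain A where A: "orthogonal_matrix A" "A *v (axis k 1) = x"
    using orthogonal_matrix_exists_basis[OF assms] by metis
  have AA: "A ** transpose A = mat 1"
    using A(1) by (simp add: orthogonal_matrix_def)
  define D :: "real^'n^'n" where "D = (\<chi> i j. if i = j then (if i = k then 1 + s else 1) else 0)"
  have x: "x $ i = A $ i $ k" for i
    using A(2) by (simp add: matrix_vector_mult_basis column_def flip: A(2))
  have "(A ** D ** transpose A) $ i $ j = ?E $ i $ j" for i j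
  proof -
    have AD: "(A ** D) $ i $ l = A $ i $ l * (if l = k then 1 + s else 1)" for l
      by (simp add: matrix_matrix_mult_def D_def if_distrib[of "\<lambda>z. _ * z"] sum.delta cong: if_cong)
    have "(A ** D ** transpose A) $ i $ j = (\<Sum>l\<in>UNIV. A $ i $ l * (if l = k then 1 + s else 1) * A $ j $ l)"
      by (simp add: matrix_matrix_mult_def[of "A ** D"] AD transpose_def)
    also have "\<dots> = (\<Sum>l\<in>UNIV. A $ i $ l * A $ j $ l + (if l = k then s * (A $ i $ k * A $ j $ k) else 0))"
      by (intro sum.cong) (auto simp: algebra_simps)
    also have "\<dots> = (A ** transpose A) $ i $ j + s * (x $ i * x $ j)"
      by (simp add: sum.distrib matrix_matrix_mult_def transpose_def x)
    finally show ?thesis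
      by (simp add: AA mat_def)
  qed
  then have "A ** D ** transpose A = ?E" by (simp add: vec_eq_iff)
  then have "det ?E = det A * det D * det (transpose A)"
    by (metis det_mul)
  also have "\<dots> = det D * det (A ** transpose A)"
    by (simp add: det_mul)
  also have "\<dots> = det D" by (simp add: AA)
  also have "\<dots> = (\<Prod>i\<in>UNIV. D $ i $ i)"
    by (rule det_diagonal) (simp add: D_def)
  also have "\<dots> = 1 + s" by (simp add: D_def)
  finally show ?thesis .
qed

lemma exists_smallest_subset:
  fixes f :: "'a \<Rightarrow> 'b::linorder"
  assumes "finite A" "k \<le> card A"
  shows "\<exists>I\<subseteq>A. card I = k \<and> (\<forall>i\<in>I. \<forall>j\<in>A - I. f i \<le> f j)"
  using assms(2)
proof (induction k)
  case 0
  then show ?case by (intro exI[of _ "{}"]) auto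
next
  case (Suc k)
  then obtain I where I: "I \<subseteq> A" "card I = k" "\<forall>i\<in>I. \<forall>j\<in>A - I. f i \<le> f j"
    by auto
  have fI: "finite I" using I(1) assms(1) finite_subset by blast
  have "A - I \<noteq> {}" using I Suc.prems by auto
  then obtain a where a: "a \<in> A - I" "\<And>j. j \<in> A - I \<Longrightarrow> f a \<le> f j"
    using assms(1) by (metis arg_min_least arg_min_if_finite(1) finite_Diff)
  show ?case
    by (rule exI[of _ "insert a I"]) (use a I fI in auto)
qed

text \<open>The vectors \<open>v i\<close> and an orthonormal basis \<open>Q\<close> of the
  complement of \<open>W\<close> are the columns of an invertible matrix \<open>C\<close>. Since
  \<open>T\<close> fixes \<open>Q\<close>, the column bound for \<open>T ** C\<close> only involves
  the images of the \<open>v i\<close>, and the constant depends on \<open>C\<close> but not on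
  \<open>T\<close>.\<close>

lemma prod_norm_image_basis_ge_det:
  fixes W :: "(real^'n) set" and v :: "'i \<Rightarrow> real^'n"
  assumes W: "subspace W" and inj: "inj_on v I" and ind: "independent (v ` I)"
    and vW: "v ` I \<subseteq> W" and card: "card I = dim W" and "finite I"
  shows "\<exists>c>0. \<forall>T. (\<forall>y\<in>W\<^sup>\<bottom>. T *v y = y) \<longrightarrow> c * \<bar>det T\<bar> \<le> (\<Prod>i\<in>I. norm (T *v v i))"
proof -
  obtain Q where Q: "Q \<subseteq> W\<^sup>\<bottom>" "\<And>x. x \<in> Q \<Longrightarrow> norm x = 1" "independent Q"
    "card Q = dim (W\<^sup>\<bottom>)" "span Q = W\<^sup>\<bottom>"
    using orthonormal_basis_subspace[OF subspace_orthogonal_comp[of W]] by metis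
  have finQ: "finite Q" using Q(3) independent_imp_finite by blast
  have dW: "dim (W\<^sup>\<bottom>) + dim W = CARD('n)"
    using dim_subspace_orthogonal_to_vectors[OF W subspace_UNIV]
    by (simp add: orthogonal_comp_def)
  define S where "S = v ` I \<union> Q"
  have spanW: "W \<subseteq> span (v ` I)"
    using card_ge_dim_independent[OF vW ind] card inj by (simp add: card_image)
  have "x \<in> span S" for x
  proof -
    obtain y z where y: "y \<in> span W" and z: "\<And>w. w \<in> span W \<Longrightarrow> orthogonal z w" and x: "x = y + z"
      using orthogonal_subspace_decomp_exists by blast
    have "y \<in> span (v ` I)" using y spanW W by (metis span_eq_iff subsetD)
    moreover have "z \<in> span Q"
      unfolding Q(5) using z by (auto simp: orthogonal_comp_def orthogonal_commute span_base)
    ultimately show ?thesis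
      unfolding x S_def by (meson span_add span_mono subsetD sup_ge1 sup_ge2)
  qed
  then have dS: "dim S = CARD('n)"
    by (metis UNIV_eq_I dim_UNIV dim_span DIM_cart DIM_real mult.right_neutral)
  have finS: "finite S" using finQ \<open>finite I\<close> S_def by simp
  have "card S \<ge> CARD('n)" using dim_le_card'[OF finS] dS by simp
  moreover have sum: "card (v ` I) + card Q = CARD('n)"
    using inj card Q(4) dW by (simp add: card_image)
  moreover have "card (v ` I) + card Q = card S + card (v ` I \<inter> Q)"
    unfolding S_def using finQ \<open>finite I\<close> by (intro card_Un_Int) auto
  ultimately have cS: "card S = CARD('n)" and "card (v ` I \<inter> Q) = 0"
    by linarith+
  then have disj: "v ` I \<inter> Q = {}" using finQ by simp
  obtain g where g: "bij_betw g (UNIV :: 'n set) S"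
    using finite_same_card_bij[OF finite finS] cS by metis
  define C :: "real^'n^'n" where "C = (\<chi> i k. g k $ i)"
  have col: "column k C = g k" for k by (simp add: column_def C_def vec_eq_iff)
  have "columns C = S"
    using g by (auto simp: columns_def col bij_betw_def)
  then have "det C \<noteq> 0"
    by (simp add: det_eq_0_rank column_rank_def dS)
  define c where "c = \<bar>det C\<bar> / fact CARD('n)"
  have "c > 0" using \<open>det C \<noteq> 0\<close> by (simp add: c_def)
  moreover have "c * \<bar>det T\<bar> \<le> (\<Prod>i\<in>I. norm (T *v v i))" if T: "\<forall>y\<in>W\<^sup>\<bottom>. T *v y = y" for T
  proof -
    have colT: "column k (T ** C) = T *v g k" for k
      by (simp add: column_def matrix_matrix_mult_def matrix_vector_mult_def C_def vec_eq_iff)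
    have "(\<Prod>k\<in>UNIV. norm (column k (T ** C))) = (\<Prod>s\<in>S. norm (T *v s))"
      unfolding colT by (rule prod.reindex_bij_betw[OF g])
    also have "\<dots> = (\<Prod>s\<in>v ` I. norm (T *v s)) * (\<Prod>s\<in>Q. norm (T *v s))"
      unfolding S_def using finQ \<open>finite I\<close> disj by (intro prod.union_disjoint) auto
    also have "(\<Prod>s\<in>Q. norm (T *v s)) = 1"
      using T Q(1,2) by (intro prod.neutral) auto
    also have "(\<Prod>s\<in>v ` I. norm (T *v s)) = (\<Prod>i\<in>I. norm (T *v v i))"
      using inj by (simp add: prod.reindex)
    finally have "\<bar>det T\<bar> * \<bar>det C\<bar> \<le> fact CARD('n) * (\<Prod>i\<in>I. norm (T *v v i))"
      using abs_det_le_prod_norm_column[of "T ** C"] by (simp add: det_mul abs_mult)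
    then show ?thesis by (simp add: c_def field_simps)
  qed
  ultimately show ?thesis by blast
qed

text \<open>
  Invertible linear maps of \<open>W\<close>, extended by the identity on the orthogonal complement, so that
  the determinant over \<open>W\<close> is the ambient one.
\<close>
definition subspace_maps :: "(real^'n) set \<Rightarrow> (real^'n^'n) set" where
  "subspace_maps W = {T. det T \<noteq> 0 \<and> (\<forall>x\<in>W. T *v x \<in> W) \<and> (\<forall>y\<in>W\<^sup>\<bottom>. T *v y = y)}"

text \<open>This bounds the potential of the isotropy argument from below. The exponents give both
  sides the same degree under scaling of \<open>T\<close> on \<open>W\<close>. One constant serves
  all \<open>T\<close>, as there are finitely many index sets of size \<open>dim W\<close>.\<close>

lemma prod_norm_image_ge_det:
  fixes W :: "(real^'n) set" and v :: "'n \<Rightarrow> real^'n"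
  assumes W: "subspace W" and vW: "\<And>j. v j \<in> W"
    and gp: "\<And>I. card I \<le> dim W \<Longrightarrow> inj_on v I \<and> independent (v ` I)"
  shows "\<exists>c>0. \<forall>T\<in>subspace_maps W. (c * \<bar>det T\<bar>) ^ CARD('n) \<le> (\<Prod>j\<in>UNIV. norm (T *v v j)) ^ dim W"
proof -
  let ?\<I> = "{I :: 'n set. card I = dim W}"
  have dle: "dim W \<le> CARD('n)" using dim_subset_UNIV[of W] by simp
  have "\<forall>I\<in>?\<I>. \<exists>c>0. \<forall>T. (\<forall>y\<in>W\<^sup>\<bottom>. T *v y = y) \<longrightarrow> c * \<bar>det T\<bar> \<le> (\<Prod>i\<in>I. norm (T *v v i))"
  proof
    fix I :: "'n set" assume "I \<in> ?\<I>"
    then show "\<exists>c>0. \<forall>T. (\<forall>y\<in>W\<^sup>\<bottom>. T *v y = y) \<longrightarrow> c * \<bar>det T\<bar> \<le> (\<Prod>i\<in>I. norm (T *v v i))"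
      using gp[of I] vW by (intro prod_norm_image_basis_ge_det[OF W]) auto
  qed
  then obtain c where c: "\<And>I. I \<in> ?\<I> \<Longrightarrow> c I > 0"
    "\<And>I T. I \<in> ?\<I> \<Longrightarrow> (\<forall>y\<in>W\<^sup>\<bottom>. T *v y = y) \<Longrightarrow> c I * \<bar>det T\<bar> \<le> (\<Prod>i\<in>I. norm (T *v v i))"
    by metis
  have ne: "?\<I> \<noteq> {}" using exists_smallest_subset[OF finite dle, of "\<lambda>_. 0::nat"] by auto
  define c0 where "c0 = Min (c ` ?\<I>)"
  have "c0 > 0" unfolding c0_def using ne c(1) by (subst Min_gr_iff) auto
  moreover have "(c0 * \<bar>det T\<bar>) ^ CARD('n) \<le> (\<Prod>j\<in>UNIV. norm (T *v v j)) ^ dim W"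
    if T: "T \<in> subspace_maps W" for T
  proof -
    define f where "f j = norm (T *v v j)" for j
    have f0: "f j \<ge> 0" for j by (simp add: f_def)
    \<comment> \<open>On the \<open>dim W\<close> shortest images the basis bound applies; each other image is at least as long
      as their geometric mean.\<close>
    obtain I where I: "card I = dim W" "\<And>i j. i \<in> I \<Longrightarrow> j \<notin> I \<Longrightarrow> f i \<le> f j"
      using exists_smallest_subset[OF finite dle, of f] by auto
    define p where "p = prod f I"
    have p0: "p \<ge> 0" using f0 by (simp add: p_def prod_nonneg)
    have "c0 \<le> c I" unfolding c0_def using I by (intro Min_le) auto
    then have "c0 * \<bar>det T\<bar> \<le> c I * \<bar>det T\<bar>" by (simp add: mult_right_mono)
    also have "\<dots> \<le> p" unfolding p_def f_def
      using T I by (intro c(2)) (auto simp: subspace_maps_def)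
    finally have "(c0 * \<bar>det T\<bar>) ^ CARD('n) \<le> p ^ CARD('n)"
      using \<open>c0 > 0\<close> by (intro power_mono) auto
    also have "\<dots> = p ^ dim W * p ^ (CARD('n) - dim W)"
      using dle by (simp flip: power_add)
    also have "p ^ (CARD('n) - dim W) = (\<Prod>j\<in>-I. p)"
      using I(1) by (simp add: Compl_eq_Diff_UNIV card_Diff_subset)
    also have "\<dots> \<le> (\<Prod>j\<in>-I. f j ^ dim W)"
    proof (intro prod_mono conjI p0)
      fix j assume "j \<in> -I"
      then have "p \<le> (\<Prod>i\<in>I. f j)"
        unfolding p_def using I(2) f0 by (intro prod_mono) auto
      then show "p \<le> f j ^ dim W" using I(1) by simp
    qed
    also have "p ^ dim W * (\<Prod>j\<in>-I. f j ^ dim W) = (prod f I * prod f (-I)) ^ dim W"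
      by (simp add: p_def power_mult_distrib prod_power_distrib)
    also have "prod f I * prod f (-I) = prod f UNIV"
      using prod.union_disjoint[of I "-I" f] by (simp add: Compl_partition)
    finally show ?thesis using p0 by (simp add: f_def mult_left_mono)
  qed
  ultimately show ?thesis by blast
qed

section \<open>Forster's position with nearly isotropic vectors\<close>

text \<open>The potential is bounded below, so some \<open>T\<close> comes within
  \<open>\<delta>\<close> of its infimum, and no minimizer has to exist. A unit vector
  \<open>x\<close> violating the bound would yield a stretched map whose potential lies below the
  infimum.\<close>

lemma approximate_isotropic_position:
  fixes W :: "(real^'n) set" and v :: "'n \<Rightarrow> real^'n"
  assumes W: "subspace W" and d: "dim W > 0" and vW: "\<And>j. v j \<in> W"
    and gp: "\<And>I. card I \<le> dim W \<Longrightarrow> inj_on v I \<and> independent (v ` I)"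
    and "\<epsilon> > 0"
  shows "\<exists>T\<in>subspace_maps W. \<forall>x\<in>W. norm x = 1 \<longrightarrow>
    (\<Sum>j\<in>UNIV. (x \<bullet> (T *v v j))\<^sup>2 / (norm (T *v v j))\<^sup>2) \<ge> CARD('n) / dim W - \<epsilon>"
proof -
  define a where "a = real CARD('n) / dim W"
  have "a > 0" using d by (simp add: a_def)
  have v0: "v j \<noteq> 0" for j
  proof -
    have "independent (v ` {j})" using gp[of "{j}"] d by auto
    then show ?thesis using dependent_zero by force
  qed
  have Tv: "norm (T *v v j) > 0" if "T \<in> subspace_maps W" for T j
  proof -
    have "inj ((*v) T)" using that by (simp add: subspace_maps_def flip: det_nz_iff_inj)
    then have "T *v v j \<noteq> 0" using v0[of j] by (metis injD matrix_vector_mult_0_right)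
    then show ?thesis by simp
  qed
  \<comment> \<open>The weight \<open>a\<close> makes \<open>f\<close> invariant under scaling of
    \<open>T\<close> on \<open>W\<close>.\<close>
  define f where "f T = (\<Sum>j\<in>UNIV. ln ((norm (T *v v j))\<^sup>2)) - a * ln ((det T)\<^sup>2)" for T :: "real^'n^'n"
  obtain c where c: "c > 0" "\<And>T. T \<in> subspace_maps W \<Longrightarrow>
      (c * \<bar>det T\<bar>) ^ CARD('n) \<le> (\<Prod>j\<in>UNIV. norm (T *v v j)) ^ dim W"
    using prod_norm_image_ge_det[OF W vW gp] by blast
  have lower: "2 * a * ln c \<le> f T" if T: "T \<in> subspace_maps W" for T
  proof -
    have dt: "\<bar>det T\<bar> > 0" using T by (simp add: subspace_maps_def)
    have "ln ((c * \<bar>det T\<bar>) ^ CARD('n)) \<le> ln ((\<Prod>j\<in>UNIV. norm (T *v v j)) ^ dim W)"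
      using c(2)[OF T] c(1) dt by (intro ln_mono) auto
    then have "CARD('n) * (ln c + ln \<bar>det T\<bar>) \<le> dim W * (\<Sum>j\<in>UNIV. ln (norm (T *v v j)))"
      using c(1) dt Tv[OF T] by (simp add: ln_realpow ln_mult ln_prod prod_pos)
    then have "a * (ln c + ln \<bar>det T\<bar>) \<le> (\<Sum>j\<in>UNIV. ln (norm (T *v v j)))"
      using d by (simp add: a_def field_simps)
    moreover have "(\<Sum>j\<in>UNIV. ln ((norm (T *v v j))\<^sup>2)) = 2 * (\<Sum>j\<in>UNIV. ln (norm (T *v v j)))"
      using Tv[OF T] by (simp add: ln_realpow sum_distrib_left)
    moreover have "ln ((det T)\<^sup>2) = 2 * ln \<bar>det T\<bar>"
      using dt by (metis ln_realpow of_nat_numeral power2_abs)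
    ultimately show ?thesis by (simp add: f_def algebra_simps)
  qed
  have ne: "mat 1 \<in> subspace_maps W" by (simp add: subspace_maps_def)
  have bdd: "bdd_below (f ` subspace_maps W)"
    using lower by (intro bdd_belowI[of _ "2 * a * ln c"]) auto
  \<comment> \<open>The squared stretch will be \<open>1 + r\<close>; here \<open>a * r\<close> is
    half of \<open>\<epsilon>\<close>, which makes the gain \<open>\<delta>\<close> below
    positive.\<close>
  define r where "r = \<epsilon> / (2 * a)"
  have r: "r > 0" "a * r < \<epsilon>" using \<open>a > 0\<close> \<open>\<epsilon> > 0\<close> by (auto simp: r_def)
  \<comment> \<open>The guaranteed decrease: the determinant term contributes
    \<open>a * ln (1 + r)\<close>, and the lengths cost at most \<open>r * (a - \<epsilon>)\<close>.
    Positivity follows from \<open>ln (1 + r) \<ge> r / (1 + r)\<close>.\<close>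
  define \<delta> where "\<delta> = a * ln (1 + r) - r * (a - \<epsilon>)"
  have "\<delta> > 0"
  proof -
    have "ln (inverse (1 + r)) \<le> inverse (1 + r) - 1"
      using r by (intro ln_le_minus_one) auto
    then have "ln (1 + r) \<ge> 1 - inverse (1 + r)" using r by (simp add: ln_inverse)
    then have "a * ln (1 + r) \<ge> a * (1 - inverse (1 + r))"
      using \<open>a > 0\<close> by simp
    moreover have "1 - inverse (1 + r) = r / (1 + r)" using r by (simp add: field_simps)
    moreover have "a * (r / (1 + r)) > r * (a - \<epsilon>)"
    proof -
      have "r * (a - \<epsilon>) * (1 + r) = a * r + r * (a * r - \<epsilon>) - \<epsilon> * r * r" by (simp add: algebra_simps)
      also have "\<dots> < a * r"
      proof -
        have "r * (a * r - \<epsilon>) < 0" using r by (intro mult_pos_neg) auto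
        moreover have "\<epsilon> * r * r > 0" using r \<open>\<epsilon> > 0\<close> by simp
        ultimately show ?thesis by linarith
      qed
      finally show ?thesis using r by (simp add: field_simps)
    qed
    ultimately show ?thesis by (simp add: \<delta>_def)
  qed
  then obtain T where T: "T \<in> subspace_maps W" "f T < Inf (f ` subspace_maps W) + \<delta>"
    using cInf_lessD[of "f ` subspace_maps W" "Inf (f ` subspace_maps W) + \<delta>"] ne by auto
  have "a - \<epsilon> \<le> (\<Sum>j\<in>UNIV. (x \<bullet> (T *v v j))\<^sup>2 / (norm (T *v v j))\<^sup>2)"
    if x: "x \<in> W" "norm x = 1" for x
  proof (rule ccontr)
    define q where "q j = (x \<bullet> (T *v v j))\<^sup>2 / (norm (T *v v j))\<^sup>2" for j
    assume "\<not> ?thesis"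
    then have q: "sum q UNIV < a - \<epsilon>" by (simp add: q_def)
    have q0: "q j \<ge> 0" for j by (simp add: q_def)
    \<comment> \<open>The map \<open>E\<close> stretches by \<open>1 + s\<close> along
      \<open>x\<close> and fixes the vectors orthogonal to \<open>x\<close>; \<open>s\<close> is
      chosen to make the squared factor \<open>1 + r\<close>.\<close>
    define s where "s = sqrt (1 + r) - 1"
    have s: "(1 + s)\<^sup>2 = 1 + r" using r by (simp add: s_def)
    define E :: "real^'n^'n" where "E = (\<chi> i j. (if i = j then 1 else 0) + s * (x $ i * x $ j))"
    have E: "E *v y = y + (s * (x \<bullet> y)) *\<^sub>R x" for y
    proof -
      have "(\<Sum>j\<in>UNIV. (if i = j then 1 else 0) * y $ j) = y $ i" for i
        by (simp add: if_distrib[of "\<lambda>z. z * _"] cong: if_cong)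
      then show ?thesis
        by (simp add: vec_eq_iff E_def matrix_vector_mult_def inner_vec_def distrib_right sum.distrib
            del: sum.delta) (simp add: sum_distrib_left sum_distrib_right mult_ac)
    qed
    have detE: "det E = 1 + s" unfolding E_def by (rule det_rank_one_perturbation[OF x(2)])
    have xx: "x \<bullet> x = 1" using x(2) by (simp add: norm_eq_1)
    have ET: "E ** T \<in> subspace_maps W"
    proof -
      have "det (E ** T) \<noteq> 0"
        using T(1) detE s r by (auto simp: det_mul subspace_maps_def)
      moreover have "(E ** T) *v y \<in> W" if "y \<in> W" for y
        using T(1) that x(1) W
        by (simp add: subspace_maps_def E subspace_add subspace_scale flip: matrix_vector_mul_assoc)
      moreover have "(E ** T) *v y = y" if "y \<in> W\<^sup>\<bottom>" for y
        using T(1) that x(1)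
        by (simp add: subspace_maps_def E orthogonal_comp_def orthogonal_def flip: matrix_vector_mul_assoc)
      ultimately show ?thesis by (simp add: subspace_maps_def)
    qed
    have nE: "(norm ((E ** T) *v v j))\<^sup>2 = (norm (T *v v j))\<^sup>2 * (1 + r * q j)" for j
    proof -
      define y where "y = T *v v j"
      have "(norm (E *v y))\<^sup>2 = y \<bullet> y + ((1 + s)\<^sup>2 - 1) * (x \<bullet> y)\<^sup>2"
        unfolding E power2_norm_eq_inner
        by (simp add: inner_add_left inner_add_right xx inner_commute power2_eq_square algebra_simps)
      also have "\<dots> = (norm y)\<^sup>2 * (1 + r * q j)"
        using Tv[OF T(1), of j] by (simp add: s q_def y_def power2_norm_eq_inner[symmetric] field_simps)
      finally show ?thesis by (simp add: y_def flip: matrix_vector_mul_assoc)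
    qed
    have "f (E ** T) = f T + (\<Sum>j\<in>UNIV. ln (1 + r * q j)) - a * ln (1 + r)"
    proof -
      have "1 + r * q j > 0" for j using r q0[of j] by (simp add: add_pos_nonneg)
      then have "(\<Sum>j\<in>UNIV. ln ((norm ((E ** T) *v v j))\<^sup>2))
          = (\<Sum>j\<in>UNIV. ln ((norm (T *v v j))\<^sup>2)) + (\<Sum>j\<in>UNIV. ln (1 + r * q j))"
        using Tv[OF T(1)] by (simp add: nE ln_mult sum.distrib less_imp_neq[symmetric])
      moreover have "ln ((det (E ** T))\<^sup>2) = ln (1 + r) + ln ((det T)\<^sup>2)"
        using T(1) r by (simp add: det_mul detE power_mult_distrib s ln_mult subspace_maps_def)
      ultimately show ?thesis by (simp add: f_def algebra_simps)
    qed
    also have "(\<Sum>j\<in>UNIV. ln (1 + r * q j)) \<le> (\<Sum>j\<in>UNIV. r * q j)"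
      using r q0 by (intro sum_mono ln_add_one_self_le_self) auto
    also have "\<dots> = r * sum q UNIV" by (simp add: sum_distrib_left)
    also have "\<dots> \<le> r * (a - \<epsilon>)" using q r by (intro mult_left_mono) auto
    finally have "f (E ** T) \<le> f T - \<delta>" by (simp add: \<delta>_def)
    moreover have "Inf (f ` subspace_maps W) \<le> f (E ** T)"
      using ET bdd by (intro cInf_lower) auto
    ultimately show False using T(2) by simp
  qed
  then show ?thesis using T(1) unfolding a_def by blast
qed

text \<open>The space \<open>W\<close> is the row space of \<open>M\<close>, the \<open>u i\<close>
  are the rows, and the \<open>v j\<close> are slightly moved projections of the coordinate vectors.
  Applying \<open>T\<close> to the \<open>v j\<close> and its inverse transpose to the
  \<open>u i\<close> keeps all inner products; normalizing then keeps all signs.\<close>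

lemma sign_realization_near_isotropic:
  fixes M :: "real^'n^'n"
  assumes M: "\<And>i j. M $ i $ j \<noteq> 0" and "\<epsilon> > 0"
  shows "\<exists>a b :: 'n \<Rightarrow> real^'n. (\<forall>i. norm (a i) = 1) \<and> (\<forall>j. norm (b j) = 1) \<and>
    (\<forall>i j. sgn (a i \<bullet> b j) = sgn (M $ i $ j)) \<and>
    (\<forall>i. (\<Sum>j\<in>UNIV. (a i \<bullet> b j)\<^sup>2) \<ge> CARD('n) / rank M - \<epsilon>)"
proof -
  define W where "W = span (rows M)"
  have W: "subspace W" by (simp add: W_def)
  have dW: "dim W = rank M" by (simp add: W_def row_rank_def)
  define u where "u i = row i M" for i
  have uW: "u i \<in> W" for i unfolding W_def u_def by (intro span_base) (auto simp: rows_def)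
  \<comment> \<open>The vectors with the sign pattern of column \<open>j\<close> form an open set,
    which leaves room for general position.\<close>
  define U where "U j = (\<Inter>i. {y. 0 < M $ i $ j * (u i \<bullet> y)})" for j
  have "open (U j)" for j
    unfolding U_def by (intro open_INT finite ballI open_Collect_less continuous_intros)
  \<comment> \<open>The projection of \<open>axis j 1\<close> to \<open>W\<close> has the same inner
    products with the rows as \<open>axis j 1\<close>, namely the entries of column
    \<open>j\<close>.\<close>
  moreover have "U j \<inter> W \<noteq> {}" for j
  proof -
    obtain y z where y: "y \<in> span W" and z: "\<And>w. w \<in> span W \<Longrightarrow> orthogonal z w"
      and e: "axis j 1 = y + z"
      using orthogonal_subspace_decomp_exists by blast
    have "u i \<bullet> y = M $ i $ j" for i
    proof -
      have "u i \<bullet> z = 0" using z[of "u i"] uW[of i] by (simp add: orthogonal_def inner_commute span_base)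
      then have "u i \<bullet> y = u i \<bullet> axis j 1" by (simp add: e inner_add_right)
      then show ?thesis by (simp add: inner_axis u_def row_def)
    qed
    then have "y \<in> U j" using M by (auto simp: U_def zero_less_mult_iff linorder_neq_iff)
    moreover have "y \<in> W" using y by (simp add: W_def span_span)
    ultimately show ?thesis by blast
  qed
  ultimately obtain v where v: "\<And>j. v j \<in> U j \<inter> W"
    and gp: "\<And>I. card I \<le> dim W \<Longrightarrow> inj_on v I \<and> independent (v ` I)"
    using exists_general_position[OF W finite, of UNIV U] by auto
  have uv: "0 < M $ i $ j * (u i \<bullet> v j)" for i j using v[of j] by (auto simp: U_def)
  obtain k :: 'n where True by simp
  have "u k \<noteq> 0" using uv[of k k] by auto
  then have "dim W > 0" using uW[of k] by (metis dim_eq_0 gr0I singletonD subsetD)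
  then obtain T where T: "T \<in> subspace_maps W"
    and iso: "\<And>x. x \<in> W \<Longrightarrow> norm x = 1 \<Longrightarrow>
      (\<Sum>j\<in>UNIV. (x \<bullet> (T *v v j))\<^sup>2 / (norm (T *v v j))\<^sup>2) \<ge> CARD('n) / dim W - \<epsilon>"
    using approximate_isotropic_position[OF W _ _ gp \<open>\<epsilon> > 0\<close>] v by blast
  have "invertible T" using T by (simp add: subspace_maps_def invertible_det_nz)
  then obtain P where P: "P ** T = mat 1" by (auto simp: invertible_def)
  define R where "R x = transpose P *v x" for x
  have RT: "R x \<bullet> (T *v y) = x \<bullet> y" for x y
    unfolding R_def transpose_matrix_vector dot_lmul_matrix by (simp add: matrix_vector_mul_assoc P)
  \<comment> \<open>Because \<open>T\<close> fixes the complement of \<open>W\<close>,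
    \<open>R x\<close> has the same inner products with it as \<open>x\<close>, namely 0. Membership
    in \<open>W\<close> allows the isotropy bound to be applied to the \<open>a i\<close>.\<close>
  have RW: "R x \<in> W" if "x \<in> W" for x
  proof -
    have "R x \<in> W\<^sup>\<bottom>\<^sup>\<bottom>"
      unfolding orthogonal_comp_def[of "W\<^sup>\<bottom>"]
    proof safe
      fix y assume y: "y \<in> W\<^sup>\<bottom>"
      then have "T *v y = y" using T by (simp add: subspace_maps_def)
      then have "R x \<bullet> y = x \<bullet> y" using RT[of x y] by simp
      then show "orthogonal y (R x)"
        using y that by (simp add: orthogonal_comp_def orthogonal_def inner_commute)
    qed
    then show ?thesis using orthogonal_comp_self[OF W] by simp
  qed
  have nz: "R (u i) \<noteq> 0" "T *v v j \<noteq> 0" for i j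
    using uv[of i j] RT[of "u i" "v j"] by auto
  define a where "a i = R (u i) /\<^sub>R norm (R (u i))" for i
  define b where "b j = (T *v v j) /\<^sub>R norm (T *v v j)" for j
  have norm_ab: "norm (a i) = 1" "norm (b i) = 1" for i using nz by (auto simp: a_def b_def)
  have "sgn (a i \<bullet> b j) = sgn (M $ i $ j)" for i j
  proof -
    have "a i \<bullet> b j = (u i \<bullet> v j) * (inverse (norm (R (u i))) * inverse (norm (T *v v j)))"
      by (simp add: a_def b_def RT)
    then have "sgn (a i \<bullet> b j) = sgn (u i \<bullet> v j)"
      using nz by (simp add: sgn_mult)
    also have "\<dots> = sgn (M $ i $ j)"
      using uv[of i j] by (auto simp: zero_less_mult_iff)
    finally show ?thesis .
  qed
  moreover have "(\<Sum>j\<in>UNIV. (a i \<bullet> b j)\<^sup>2) \<ge> CARD('n) / rank M - \<epsilon>" for i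
  proof -
    have "a i \<in> W" unfolding a_def using RW[OF uW] W by (simp add: subspace_scale)
    moreover have "(a i \<bullet> b j)\<^sup>2 = (a i \<bullet> (T *v v j))\<^sup>2 / (norm (T *v v j))\<^sup>2" for j
      by (simp add: b_def power_mult_distrib field_simps)
    ultimately show ?thesis
      using iso[of "a i"] norm_ab by (simp add: dW)
  qed
  ultimately show ?thesis using norm_ab by blast
qed

section \<open>Upper bound for the pairing\<close>

text \<open>Each coordinate \<open>k\<close> contributes a bilinear form
  \<open>\<alpha> k \<bullet> (E *v \<beta> k)\<close>, bounded by Cauchy-Schwarz and the
  arithmetic-geometric mean inequality. The squared norms of the \<open>\<alpha> k\<close>, and
  likewise of the \<open>\<beta> k\<close>, add up to the number of unit vectors, so the dimension
  of the vectors does not enter.\<close>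

lemma sum_matrix_inner_le:
  fixes E :: "real^'n^'n" and a b :: "'n \<Rightarrow> real^'k"
  assumes E: "\<And>y. norm (E *v y) \<le> s * norm y" and "s \<ge> 0"
    and a: "\<And>i. norm (a i) = 1" and b: "\<And>j. norm (b j) = 1"
  shows "(\<Sum>i\<in>UNIV. \<Sum>j\<in>UNIV. E $ i $ j * (a i \<bullet> b j)) \<le> s * CARD('n)"
proof -
  define \<alpha> :: "'k \<Rightarrow> real^'n" where "\<alpha> k = (\<chi> i. a i $ k)" for k
  define \<beta> :: "'k \<Rightarrow> real^'n" where "\<beta> k = (\<chi> j. b j $ k)" for k
  have n: "(\<Sum>k\<in>UNIV. (norm (\<chi> i. c i $ k))\<^sup>2) = CARD('n)" if c: "\<And>i. norm (c i) = 1"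
    for c :: "'n \<Rightarrow> real^'k"
  proof -
    have "(\<Sum>k\<in>UNIV. (norm (\<chi> i. c i $ k))\<^sup>2) = (\<Sum>i\<in>UNIV. (norm (c i))\<^sup>2)"
      unfolding power2_norm_eq_inner inner_vec_def by (subst sum.swap) simp
    then show ?thesis by (simp add: c)
  qed
  have "(\<Sum>i\<in>UNIV. \<Sum>j\<in>UNIV. E $ i $ j * (a i \<bullet> b j))
      = (\<Sum>i\<in>UNIV. \<Sum>j\<in>UNIV. \<Sum>k\<in>UNIV. a i $ k * (E $ i $ j * b j $ k))"
    by (simp add: inner_vec_def sum_distrib_left mult_ac)
  also have "\<dots> = (\<Sum>i\<in>UNIV. \<Sum>k\<in>UNIV. \<Sum>j\<in>UNIV. a i $ k * (E $ i $ j * b j $ k))"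
    by (intro sum.cong refl sum.swap)
  also have "\<dots> = (\<Sum>k\<in>UNIV. \<Sum>i\<in>UNIV. \<Sum>j\<in>UNIV. a i $ k * (E $ i $ j * b j $ k))"
    by (rule sum.swap)
  also have "\<dots> = (\<Sum>k\<in>UNIV. \<alpha> k \<bullet> (E *v \<beta> k))"
    by (simp add: \<alpha>_def \<beta>_def inner_vec_def matrix_vector_mult_def sum_distrib_left)
  also have "\<dots> \<le> (\<Sum>k\<in>UNIV. s * ((norm (\<alpha> k))\<^sup>2 + (norm (\<beta> k))\<^sup>2) / 2)"
  proof (rule sum_mono)
    fix k
    have "\<alpha> k \<bullet> (E *v \<beta> k) \<le> norm (\<alpha> k) * (s * norm (\<beta> k))"
      by (meson E mult_left_mono norm_cauchy_schwarz norm_ge_zero order_trans)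
    also have "\<dots> = s * (2 * norm (\<alpha> k) * norm (\<beta> k)) / 2" by simp
    also have "\<dots> \<le> s * ((norm (\<alpha> k))\<^sup>2 + (norm (\<beta> k))\<^sup>2) / 2"
      using \<open>s \<ge> 0\<close> by (intro divide_right_mono mult_left_mono sum_squares_bound) auto
    finally show "\<alpha> k \<bullet> (E *v \<beta> k) \<le> s * ((norm (\<alpha> k))\<^sup>2 + (norm (\<beta> k))\<^sup>2) / 2" .
  qed
  also have "\<dots> = s * ((\<Sum>k\<in>UNIV. (norm (\<alpha> k))\<^sup>2) + (\<Sum>k\<in>UNIV. (norm (\<beta> k))\<^sup>2)) / 2"
    by (simp add: sum.distrib flip: sum_distrib_left sum_divide_distrib)
  also have "\<dots> = s * CARD('n)"
    unfolding \<alpha>_def \<beta>_def using n[of a] n[of b] a b by simp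
  finally show ?thesis .
qed

section \<open>Singular vectors and the second singular value\<close>

lemma inner_gram_matrix:
  fixes A :: "real^'n^'m"
  shows "y \<bullet> ((transpose A ** A) *v z) = (A *v y) \<bullet> (A *v z)"
  by (metis dot_lmul_matrix inner_commute matrix_vector_mul_assoc transpose_matrix_vector)

text \<open>A maximizer \<open>x\<close> of \<open>norm (A *v x)\<close> on the unit sphere of the
  hyperplane orthogonal to \<open>e\<close> exists by compactness. The residual \<open>w\<close> of
  the eigenvector equation is orthogonal to \<open>e\<close>, as \<open>e\<close> is an eigenvector
  of the symmetric \<open>G\<close>; so \<open>x\<close> may be varied along \<open>w\<close>, and
  maximality forces \<open>w = 0\<close>.\<close>

lemma exists_top_singular_vector_orthogonal_to:
  fixes A :: "real^'n^'m" and e :: "real^'n"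
  assumes card: "CARD('n) \<ge> 2" and e: "e \<in> eigenspace (transpose A ** A) k"
  shows "\<exists>x. norm x = 1 \<and> e \<bullet> x = 0 \<and> x \<in> eigenspace (transpose A ** A) ((norm (A *v x))\<^sup>2) \<and>
    (\<forall>y. e \<bullet> y = 0 \<longrightarrow> norm (A *v y) \<le> norm (A *v x) * norm y)"
proof -
  define G where "G = transpose A ** A"
  have G: "y \<bullet> (G *v z) = (A *v y) \<bullet> (A *v z)" for y z
    unfolding G_def by (rule inner_gram_matrix)
  have Ge: "G *v e = k *\<^sub>R e" using e by (simp add: eigenspace_def G_def)
  let ?S = "sphere 0 1 \<inter> {x. e \<bullet> x = 0}"
  have "compact ?S" by (intro compact_Int_closed compact_sphere closed_hyperplane)
  moreover obtain z :: "real^'n" where "z \<noteq> 0" "orthogonal e z"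
    using orthogonal_to_vector_exists[of e] card by auto
  then have "z /\<^sub>R norm z \<in> ?S" by (simp add: orthogonal_def)
  then have "?S \<noteq> {}" by blast
  moreover have "continuous_on ?S (\<lambda>x. norm (A *v x))"
    by (intro continuous_intros linear_continuous_on) simp
  ultimately obtain x where x: "norm x = 1" "e \<bullet> x = 0"
    and max: "\<And>y. norm y = 1 \<Longrightarrow> e \<bullet> y = 0 \<Longrightarrow> norm (A *v y) \<le> norm (A *v x)"
    using continuous_attains_sup[of ?S "\<lambda>x. norm (A *v x)"]
    by (metis (mono_tags, lifting) IntD1 IntD2 IntI mem_Collect_eq mem_sphere_0)
  have bound: "norm (A *v y) \<le> norm (A *v x) * norm y" if "e \<bullet> y = 0" for y
  proof (cases "y = 0")
    case False
    then have "norm (A *v (y /\<^sub>R norm y)) \<le> norm (A *v x)"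
      using that by (intro max) auto
    then show ?thesis using False
      by (simp add: matrix_vector_mult_scaleR divide_simps)
  qed simp
  define l where "l = (norm (A *v x))\<^sup>2"
  define w where "w = l *\<^sub>R x - G *v x"
  have "e \<bullet> (G *v x) = (G *v e) \<bullet> x"
    using G[of e x] G[of x e] by (simp add: inner_commute)
  then have ew: "e \<bullet> w = 0" using x by (simp add: w_def inner_diff_right Ge)
  define q where "q = l * (w \<bullet> w) - (A *v w) \<bullet> (A *v w)"
  have quad: "0 \<le> 2 * t * (w \<bullet> w) + t\<^sup>2 * q" for t
  proof -
    define y where "y = x + t *\<^sub>R w"
    have "e \<bullet> y = 0" using x ew by (simp add: y_def inner_add_right)
    then have "(norm (A *v y))\<^sup>2 \<le> (norm (A *v x) * norm y)\<^sup>2"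
      using bound by (intro power_mono) auto
    then have le: "(A *v y) \<bullet> (A *v y) \<le> l * (y \<bullet> y)"
      by (simp add: l_def power_mult_distrib power2_norm_eq_inner)
    have "A *v y = A *v x + t *\<^sub>R (A *v w)"
      by (simp add: y_def matrix_vector_right_distrib matrix_vector_mult_scaleR)
    then have Ayy: "(A *v y) \<bullet> (A *v y) = l + 2 * t * (w \<bullet> (G *v x)) + t\<^sup>2 * ((A *v w) \<bullet> (A *v w))"
      by (simp add: inner_add_left inner_add_right G inner_commute power2_eq_square
          algebra_simps l_def[unfolded power2_norm_eq_inner])
    have yy: "y \<bullet> y = 1 + 2 * t * (w \<bullet> x) + t\<^sup>2 * (w \<bullet> w)"
      using x by (simp add: y_def inner_add_left inner_add_right norm_eq_1 inner_commute
          power2_eq_square algebra_simps)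
    have ww: "w \<bullet> w = l * (w \<bullet> x) - w \<bullet> (G *v x)"
      by (subst (2) w_def) (simp add: inner_diff_right)
    have "l * (y \<bullet> y) - (A *v y) \<bullet> (A *v y) = 2 * t * (l * (w \<bullet> x) - w \<bullet> (G *v x)) + t\<^sup>2 * q"
      unfolding Ayy yy q_def by (simp add: algebra_simps)
    then show ?thesis using le by (simp flip: ww)
  qed
  have "w \<bullet> w \<le> 0"
  proof (rule ccontr)
    assume pos: "\<not> w \<bullet> w \<le> 0"
    \<comment> \<open>A negative step so short that the quadratic term offsets at most half of the
      linear one.\<close>
    define t where "t = - (w \<bullet> w) / (\<bar>q\<bar> + 1)"
    have t: "t < 0" unfolding t_def using pos by (intro divide_neg_pos) auto
    have "t\<^sup>2 * q \<le> t\<^sup>2 * (\<bar>q\<bar> + 1)" by (intro mult_left_mono) auto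
    also have "\<dots> = - t * (w \<bullet> w)" by (simp add: t_def power2_eq_square)
    finally have "2 * t * (w \<bullet> w) + t\<^sup>2 * q \<le> t * (w \<bullet> w)" by simp
    also have "\<dots> < 0" using t pos by (intro mult_neg_pos) auto
    finally show False using quad[of t] by simp
  qed
  then have "w = 0" by (metis inner_gt_zero_iff not_le)
  then have "x \<in> eigenspace G l" by (simp add: eigenspace_def w_def)
  then show ?thesis using x bound unfolding G_def l_def by blast
qed

text \<open>The head of the decreasing list accounts for at most one of the two occurrences, so
  \<open>a\<close> or \<open>b\<close> occurs in the tail, whose largest element has index
  1.\<close>

lemma sorted_rev_nth_1_ge:
  fixes xs :: "'a::linorder list"
  assumes "sorted (rev xs)" and sub: "{#a, b#} \<subseteq># mset xs"
  shows "min a b \<le> xs ! 1"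
proof -
  obtain ys where "mset xs = {#a, b#} + ys" using sub by (metis subset_mset.le_iff_add)
  then have "xs \<noteq> []" "a \<in># mset xs" by auto
  show ?thesis
  proof (cases xs)
    case Nil
    then show ?thesis using \<open>xs \<noteq> []\<close> by simp
  next
    case (Cons x zs)
    have desc: "sorted_wrt (\<ge>) xs" using assms(1) by (simp add: sorted_wrt_rev)
    have "\<exists>c\<in>set zs. min a b \<le> c"
    proof (cases "x = a")
      case True
      then have "b \<in> set zs" using sub Cons by simp
      then show ?thesis by (intro bexI[of _ b]) auto
    next
      case False
      have "a \<in> set zs" using \<open>a \<in># mset xs\<close> Cons False by simp
      then show ?thesis by (intro bexI[of _ a]) auto
    qed
    then obtain c where c: "c \<in> set zs" "min a b \<le> c" by blast
    then obtain y ws where zs: "zs = y # ws" by (cases zs) auto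
    have "c \<le> y" using c desc Cons zs by auto
    then show ?thesis using c Cons zs by simp
  qed
qed

text \<open>Orthogonality gives two separate entries in the list of singular values: equal
  eigenvalues have an eigenspace of dimension at least 2, and distinct ones contribute an entry
  each.\<close>

lemma singular_value_2_ge:
  fixes A :: "real^'n^'m"
  assumes x: "x \<in> eigenspace (transpose A ** A) l" "x \<noteq> 0"
    and y: "y \<in> eigenspace (transpose A ** A) k" "y \<noteq> 0" and orth: "x \<bullet> y = 0"
  shows "min (sqrt l) (sqrt k) \<le> singular_value 2 A"
proof -
  define G where "G = transpose A ** A"
  define f where "f m = replicate_mset (dim (eigenspace G m)) (sqrt m)" for m
  have fin: "finite (eigenvalues G)"
    by (rule finite_eigenvalues_symmetric) (simp add: G_def matrix_transpose_mul)
  have lk: "l \<in> eigenvalues G" "k \<in> eigenvalues G"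
    using x y by (auto simp: eigenvalues_def G_def)
  have xy: "x \<noteq> y" using orth x(2) by auto
  have "{#sqrt l, sqrt k#} \<subseteq># sum f (eigenvalues G)"
  proof (cases "l = k")
    case True
    have "independent {x, y}"
      using orth x(2) y(2) xy
      by (intro pairwise_orthogonal_independent) (auto simp: pairwise_def orthogonal_def inner_commute)
    then have "card {x, y} \<le> dim (eigenspace G l)"
      using x y True by (intro independent_card_le_dim) (auto simp: G_def)
    then have "2 \<le> dim (eigenspace G l)" using xy by simp
    then obtain m where "dim (eigenspace G l) = Suc (Suc m)" by (metis add_2_eq_Suc le_Suc_ex)
    then have "{#sqrt l, sqrt k#} \<subseteq># f l" by (simp add: f_def True)
    also have "\<dots> \<subseteq># sum f (eigenvalues G)"
      using fin lk by (simp add: sum.remove)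
    finally show ?thesis .
  next
    case False
    have single: "{#sqrt m#} \<subseteq># f m" if "z \<in> eigenspace G m" "z \<noteq> 0" for m z
    proof -
      have "dim (eigenspace G m) \<noteq> 0" using that by (auto simp: dim_eq_0)
      then obtain n where "dim (eigenspace G m) = Suc n" using not0_implies_Suc by blast
      then show ?thesis by (simp add: f_def)
    qed
    have "{#sqrt l#} + {#sqrt k#} \<subseteq># f l + f k"
      using single x y by (intro subset_mset.add_mono) (auto simp: G_def)
    also have "f l + f k \<subseteq># f l + (f k + sum f (eigenvalues G - {l} - {k}))" by simp
    also have "\<dots> = sum f (eigenvalues G)"
      using fin lk False by (simp add: sum.remove[of _ l] sum.remove[of _ k])
    finally show ?thesis by (simp add: add_mset_commute)
  qed
  then show ?thesis
    using sorted_rev_nth_1_ge[of "singular_values A"]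
    by (simp add: singular_value_def singular_values_def G_def f_def[abs_def])
qed

section \<open>Regular boolean matrices and the rank of a sign realization\<close>

lemma boolean_matrix_row_sum:
  assumes "boolean_matrix B"
  shows "(\<Sum>j\<in>UNIV. B $ i $ j) = real (card {j. B $ i $ j = 1})"
proof -
  have "(\<Sum>j\<in>UNIV. B $ i $ j) = (\<Sum>j\<in>UNIV. if B $ i $ j = 1 then 1 else 0)"
    using assms by (intro sum.cong) (auto simp: boolean_matrix_def)
  then show ?thesis by (simp add: sum.If_cases)
qed

lemma regular_matrix_mult_1:
  assumes "boolean_matrix B" "regular_matrix \<Delta> B"
  shows "B *v 1 = real \<Delta> *\<^sub>R 1"
  using assms boolean_matrix_row_sum[OF assms(1)]
  by (simp add: vec_eq_iff matrix_vector_mult_def regular_matrix_def)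

lemma regular_matrix_transpose:
  "boolean_matrix (transpose B) \<longleftrightarrow> boolean_matrix B"
  "regular_matrix \<Delta> (transpose B) \<longleftrightarrow> regular_matrix \<Delta> B"
  by (auto simp: boolean_matrix_def regular_matrix_def transpose_def)

text \<open>Here \<open>s\<close> is any bound for \<open>B\<close> on the complement of the
  all-ones vector; its link to the second singular value is made only in the theorem.\<close>

lemma degree_le_rank_mult_expansion:
  fixes B M :: "real^'n^'n"
  assumes B: "boolean_matrix B" "regular_matrix \<Delta> B" and half: "real \<Delta> \<le> real CARD('n) / 2"
    and M: "\<And>i j. M $ i $ j \<noteq> 0" "\<And>i j. sgn (M $ i $ j) = 2 * B $ i $ j - 1"
    and s: "s \<ge> 0" "\<And>y. 1 \<bullet> y = 0 \<Longrightarrow> norm (B *v y) \<le> s * norm y"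
  shows "real \<Delta> \<le> s * rank M"
proof -
  define N where "N = real CARD('n)"
  have "N > 0" by (simp add: N_def)
  define \<delta> where "\<delta> = real \<Delta> / N"
  have \<delta>: "0 \<le> \<delta>" "\<delta> \<le> 1 - \<delta>" using half \<open>N > 0\<close> by (auto simp: \<delta>_def N_def field_simps)
  define E where "E = B - \<delta> *\<^sub>R all_ones"
  have E: "norm (E *v y) \<le> s * norm y" for y
  proof -
    \<comment> \<open>The mean entry of \<open>y\<close>: subtracting \<open>m *\<^sub>R 1\<close>
      projects \<open>y\<close> to the complement of the all-ones vector, and \<open>E\<close> is
      this projection followed by \<open>B\<close>.\<close>
    define m where "m = (1 \<bullet> y) / N"
    have N1: "(1 :: real^'n) \<bullet> 1 = N" by (simp add: inner_vec_def N_def)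
    then have orth: "1 \<bullet> (y - m *\<^sub>R 1) = 0"
      using \<open>N > 0\<close> by (simp add: inner_diff_right m_def)
    have J: "all_ones *v y = (1 \<bullet> y) *\<^sub>R (1 :: real^'n)"
      by (simp add: all_ones_def vec_eq_iff matrix_vector_mult_def inner_vec_def)
    have "E *v y = B *v y - \<delta> *\<^sub>R (all_ones *v y)"
      by (simp add: E_def matrix_vector_mult_diff_rdistrib scaleR_matrix_vector_assoc)
    also have "\<dots> = B *v (y - m *\<^sub>R 1)"
      using regular_matrix_mult_1[OF B] \<open>N > 0\<close>
      by (simp add: matrix_vector_mult_diff_distrib matrix_vector_mult_scaleR J m_def \<delta>_def)
    finally have "norm (E *v y) \<le> s * norm (y - m *\<^sub>R 1)"
      using s(2)[OF orth] by simp
    moreover have "norm (y - m *\<^sub>R 1) \<le> norm y"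
    proof -
      have "orthogonal (y - m *\<^sub>R 1) (m *\<^sub>R 1)"
        using orth by (simp add: orthogonal_def inner_commute)
      then have "(norm y)\<^sup>2 = (norm (y - m *\<^sub>R 1))\<^sup>2 + (norm (m *\<^sub>R 1 :: real^'n))\<^sup>2"
        using norm_add_Pythagorean[of "y - m *\<^sub>R 1" "m *\<^sub>R 1"] by simp
      then have "(norm (y - m *\<^sub>R 1))\<^sup>2 \<le> (norm y)\<^sup>2"
        using zero_le_power2[of "norm (m *\<^sub>R 1 :: real^'n)"] by linarith
      then show ?thesis by (rule power2_le_imp_le) simp
    qed
    ultimately show ?thesis using s(1) by (meson mult_left_mono order_trans)
  qed
  obtain k :: 'n where True by simp
  have "rank M \<noteq> 0"
  proof
    assume "rank M = 0"
    then have "rows M \<subseteq> {0}" by (simp add: row_rank_def)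
    moreover have "row k M \<in> rows M" by (auto simp: rows_def)
    ultimately have "row k M = 0" by blast
    then show False using M(1)[of k k] by (simp add: row_def vec_eq_iff)
  qed
  have approx: "real \<Delta> * (N / rank M - \<epsilon>) \<le> s * N" if \<epsilon>: "\<epsilon> > 0" for \<epsilon>
  proof -
    obtain a b :: "'n \<Rightarrow> real^'n" where ab: "\<And>i. norm (a i) = 1" "\<And>j. norm (b j) = 1"
      and sg: "\<And>i j. sgn (a i \<bullet> b j) = sgn (M $ i $ j)"
      and iso: "\<And>i. (\<Sum>j\<in>UNIV. (a i \<bullet> b j)\<^sup>2) \<ge> N / rank M - \<epsilon>"
      using sign_realization_near_isotropic[OF M(1) \<epsilon>] unfolding N_def by blast
    \<comment> \<open>The entry of \<open>E\<close> is \<open>- \<delta>\<close> where the inner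
      product is negative and \<open>1 - \<delta>\<close>, at least \<open>\<delta>\<close>, where
      it is positive. Unit length lets the square replace the absolute value.\<close>
    have "\<delta> * (a i \<bullet> b j)\<^sup>2 \<le> E $ i $ j * (a i \<bullet> b j)" for i j
    proof -
      define t where "t = a i \<bullet> b j"
      have "\<bar>t\<bar> \<le> 1" using Cauchy_Schwarz_ineq2[of "a i" "b j"] ab by (simp add: t_def)
      then have "t\<^sup>2 \<le> \<bar>t\<bar>"
        using mult_left_le[of "\<bar>t\<bar>" "\<bar>t\<bar>"] by (simp add: power2_eq_square)
      then have "\<delta> * t\<^sup>2 \<le> \<delta> * \<bar>t\<bar>" using \<delta> by (intro mult_left_mono)
      also have "\<dots> \<le> E $ i $ j * t"
      proof -
        have sgt: "sgn t = 2 * B $ i $ j - 1" using sg M(2) by (simp add: t_def)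
        consider "B $ i $ j = 0" | "B $ i $ j = 1" using B(1) by (auto simp: boolean_matrix_def)
        then show ?thesis
        proof cases
          case 1
          then have "t < 0" using sgt by (simp add: sgn_if split: if_splits)
          then show ?thesis using 1 by (simp add: E_def all_ones_def)
        next
          case 2
          then have "t > 0" using sgt by (simp add: sgn_if split: if_splits)
          then show ?thesis using 2 \<delta> by (simp add: E_def all_ones_def mult_right_mono)
        qed
      qed
      finally show ?thesis by (simp add: t_def)
    qed
    then have "(\<Sum>i\<in>UNIV. \<Sum>j\<in>UNIV. \<delta> * (a i \<bullet> b j)\<^sup>2) \<le> (\<Sum>i\<in>UNIV. \<Sum>j\<in>UNIV. E $ i $ j * (a i \<bullet> b j))"
      by (intro sum_mono)
    also have "\<dots> \<le> s * N"
      unfolding N_def by (rule sum_matrix_inner_le[OF E s(1) ab])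
    finally have "\<delta> * (\<Sum>i\<in>UNIV. \<Sum>j\<in>UNIV. (a i \<bullet> b j)\<^sup>2) \<le> s * N"
      by (simp add: sum_distrib_left)
    moreover have "(\<Sum>i\<in>UNIV. \<Sum>j\<in>UNIV. (a i \<bullet> b j)\<^sup>2) \<ge> (\<Sum>i\<in>(UNIV::'n set). N / rank M - \<epsilon>)"
      using iso by (intro sum_mono)
    then have "\<delta> * (N * (N / rank M - \<epsilon>)) \<le> \<delta> * (\<Sum>i\<in>UNIV. \<Sum>j\<in>UNIV. (a i \<bullet> b j)\<^sup>2)"
      using \<delta> by (intro mult_left_mono) (auto simp: N_def)
    ultimately show ?thesis using \<open>N > 0\<close> by (simp add: \<delta>_def)
  qed
  have "real \<Delta> * (N / rank M) \<le> s * N"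
  proof (rule field_le_epsilon)
    fix e :: real assume "e > 0"
    \<comment> \<open>The summand 1 keeps the denominator positive for \<open>\<Delta> = 0\<close>
      as well.\<close>
    have "real \<Delta> * (N / rank M - e / (real \<Delta> + 1)) \<le> s * N"
      using \<open>e > 0\<close> by (intro approx) (simp add: add_nonneg_pos)
    moreover have "real \<Delta> * (e / (real \<Delta> + 1)) \<le> e"
      using \<open>e > 0\<close> by (simp add: field_simps)
    ultimately show "real \<Delta> * (N / rank M) \<le> s * N + e" by (simp add: right_diff_distrib)
  qed
  then show ?thesis using \<open>N > 0\<close> \<open>rank M \<noteq> 0\<close> by (simp add: field_simps)
qed

section \<open>The sign rank bound\<close>

theorem theorem8:
  fixes B S :: "real^'n^'n" and \<Delta> :: nat
  assumes "boolean_matrix B"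
    and "regular_matrix \<Delta> B"
    and "real \<Delta> \<le> real CARD('n) / 2"
    and "S = 2 *\<^sub>R B - all_ones"
  shows "real (sign_rank S) \<ge> real \<Delta> / singular_value 2 B"
proof (cases "\<Delta> = 0")
  case True
  then show ?thesis by simp
next
  case False
  \<comment> \<open>At least two columns ensure a nonzero vector orthogonal to the all-ones vector
    and the existence of a second singular value.\<close>
  then have card: "CARD('n) \<ge> 2" using assms(3) by linarith
  have S: "S $ i $ j = 2 * B $ i $ j - 1" for i j using assms(4) by (simp add: all_ones_def)
  have S1: "S $ i $ j = 1 \<or> S $ i $ j = - 1" for i j
    using assms(1) S by (auto simp: boolean_matrix_def)
  let ?R = "{rank M | M :: real^'n^'n. \<forall>i j. M $ i $ j \<noteq> 0 \<and> sgn (M $ i $ j) = S $ i $ j}"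
  have "S $ i $ j \<noteq> 0 \<and> sgn (S $ i $ j) = S $ i $ j" for i j using S1[of i j] by auto
  \<comment> \<open>A nonempty set of naturals attains its infimum, so some \<open>M\<close>
    realizes the sign rank.\<close>
  then have "rank S \<in> ?R" by blast
  then have "sign_rank S \<in> ?R" unfolding sign_rank_def by (intro Inf_nat_def1) blast
  then obtain M :: "real^'n^'n" where rank: "sign_rank S = rank M"
    and M: "\<And>i j. M $ i $ j \<noteq> 0" "\<And>i j. sgn (M $ i $ j) = 2 * B $ i $ j - 1"
    using S by auto
  have "(transpose B ** B) *v 1 = (real \<Delta>)\<^sup>2 *\<^sub>R 1"
    using regular_matrix_mult_1[OF assms(1,2)] regular_matrix_mult_1[of "transpose B" \<Delta>] assms(1,2)
    by (simp add: regular_matrix_transpose matrix_vector_mult_scaleR power2_eq_square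
        flip: matrix_vector_mul_assoc)
  then have one: "1 \<in> eigenspace (transpose B ** B) ((real \<Delta>)\<^sup>2)" by (simp add: eigenspace_def)
  obtain x where x: "norm x = 1" "1 \<bullet> x = 0" "x \<in> eigenspace (transpose B ** B) ((norm (B *v x))\<^sup>2)"
    and bound: "\<And>y. 1 \<bullet> y = 0 \<Longrightarrow> norm (B *v y) \<le> norm (B *v x) * norm y"
    using exists_top_singular_vector_orthogonal_to[OF card one] by blast
  have deg: "real \<Delta> \<le> norm (B *v x) * rank M"
    using degree_le_rank_mult_expansion[OF assms(1-3) M _ bound] by simp
  then have "rank M \<noteq> 0" using False by (metis mult_zero_right of_nat_0 of_nat_le_0_iff)
  have "x \<noteq> 0" using x(1) by auto
  \<comment> \<open>The all-ones vector and \<open>x\<close> are orthogonal singular vectors. Which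
    of their singular values is smaller is left open: if \<open>\<Delta>\<close> is below the second
    one, rank at least 1 already suffices.\<close>
  then have "min (real \<Delta>) (norm (B *v x)) \<le> singular_value 2 B"
    using singular_value_2_ge[OF one _ x(3)] x(2) by simp
  then consider "real \<Delta> \<le> singular_value 2 B" | "norm (B *v x) \<le> singular_value 2 B" by linarith
  then have "real \<Delta> \<le> singular_value 2 B * rank M"
  proof cases
    case 1
    moreover have "singular_value 2 B * 1 \<le> singular_value 2 B * rank M"
      using 1 \<open>rank M \<noteq> 0\<close> by (intro mult_left_mono) auto
    ultimately show ?thesis by simp
  next
    case 2
    then show ?thesis using deg by (meson mult_right_mono of_nat_0_le_iff order_trans)
  qed
  moreover from this have "singular_value 2 B > 0"
    using False by (metis linorder_not_le mult_nonpos_nonneg of_nat_0_le_iff of_nat_le_0_iff order_trans)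
  ultimately show ?thesis by (simp add: rank field_simps)
qed

end
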